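(* Fix a class $j$, in the setting described in the context. Let $\hat q_j=\frac1n\sum_{i=1}^n g(X_i,\hat\theta_j)$ be the estimator of $q_j=E[Y^{(j)}]$ based on both the labeled and unlabeled data, and let $\bar Y^{(j)}=\frac1r\sum_{i=1}^r Y_i^{(j)}$ be the estimator based only on labeled data. Then the asymptotic variance of $\hat q_j$ is less than or equal to that of $\bar Y^{(j)}$. The inequality is strict as long as the random variable $g(X,\theta_j)$ is not constant.
   Context: The data are a random sample $(X_i,Y_i)$, $i=1,\dots,n$, from the distribution of $(X,Y)$, where $X$ is a feature vector and $Y=(Y^{(1)},\dots,Y^{(c)})^T$ is the class identification vector: $Y^{(j)}$ is 1 or 0 according to whether the item belongs to class $j$. $Y_i^{(j)}$ is component $j$ of $Y_i$. All the $X_i$ are observed; $Y_i$ is known for $i=1,\dots,r$ (labeled observations) but unknown for $i=r+1,\dots,n$ (unlabeled observations), and some observations are unlabeled, i.e. $r<n$. It is assumed that $r/n\to\gamma$ as $n\to\infty$. Semiparametric model: $P(Y^{(j)}=1\mid X=t)=g(t,\theta_j)$ for a parametric family $g(t,\theta)$ and a vector-valued parameter $\theta_j$; no parametric model is assumed for the distribution of $X$. $g'$ is the vector of partial derivatives of $g$ with respect to its second argument, and $$w(t,\theta_j)=\frac{1}{Var(Y^{(j)}\mid X=t)}=\frac{1}{g(t,\theta_j)[1-g(t,\theta_j)]}.$$ The estimator $\hat\theta_j$ is computed from the labeled data by iteratively reweighted least squares, i.e. it is the root of $0=\sum_{i=1}^r w(X_i,\hat\theta_j)\{Y_i^{(j)}-g(X_i,\hat\theta_j)\}\,g'(X_i,\hat\theta_j)$.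 It is assumed that $g$ satisfies the smoothness conditions needed for the standard asymptotic theory of (nonlinear, weighted) least squares estimators, such as those given by Jennrich, and that the required means exist. The asymptotic variance of an estimator is the variance of its large-sample normal approximation; for $\hat q_j$ it is $$\frac1n Var[g(X,\theta_j)]+\frac1r B_j^TA_j^{-1}B_j,$$ where $A_j=E\{w(X,\theta_j)g'(X,\theta_j)g'(X,\theta_j)^T\}$ and $B_j=E[g'(X,\theta_j)]$. *)

theory Defs
  imports "HOL-Probability.Probability"
begin

text \<open>\<open>g t \<theta> * (1 - g t \<theta>)\<close> is the conditional variance of the class indicator given \<open>X = t\<close>.\<close>

definition weight :: "('x \<Rightarrow> 'q \<Rightarrow> real) \<Rightarrow> 'x \<Rightarrow> 'q \<Rightarrow> real" where
  "weight g t \<theta> = 1 / (g t \<theta> * (1 - g t \<theta>))"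

definition outer :: "real ^ 'p \<Rightarrow> real ^ 'p ^ 'p" where
  "outer v = (\<chi> a b. v $ a * v $ b)"

definition info_matrix ::
  "'a measure \<Rightarrow> ('x \<Rightarrow> real ^ 'p \<Rightarrow> real) \<Rightarrow> ('x \<Rightarrow> real ^ 'p \<Rightarrow> real ^ 'p) \<Rightarrow>
    ('a \<Rightarrow> 'x) \<Rightarrow> real ^ 'p \<Rightarrow> real ^ 'p ^ 'p" where
  "info_matrix M g g' X \<theta> = (\<integral>\<omega>. weight g (X \<omega>) \<theta> *\<^sub>R outer (g' (X \<omega>) \<theta>) \<partial>M)"

definition mean_grad ::
  "'a measure \<Rightarrow> ('x \<Rightarrow> real ^ 'p \<Rightarrow> real ^ 'p) \<Rightarrow> ('a \<Rightarrow> 'x) \<Rightarrow> real ^ 'p \<Rightarrow> real ^ 'p" where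
  "mean_grad M g' X \<theta> = (\<integral>\<omega>. g' (X \<omega>) \<theta> \<partial>M)"

text \<open>Samples are indexed from 0: observations \<open>i < m\<close> are labeled, observations
  \<open>m \<le> i < n\<close> are unlabeled. Here \<open>y i\<close> is the indicator of a single class.\<close>

definition irls_score ::
  "('x \<Rightarrow> real ^ 'p \<Rightarrow> real) \<Rightarrow> ('x \<Rightarrow> real ^ 'p \<Rightarrow> real ^ 'p) \<Rightarrow> nat \<Rightarrow>
    (nat \<Rightarrow> 'x) \<Rightarrow> (nat \<Rightarrow> real) \<Rightarrow> real ^ 'p \<Rightarrow> real ^ 'p" where
  "irls_score g g' m x y \<theta> = (\<Sum>i<m. (weight g (x i) \<theta> * (y i - g (x i) \<theta>)) *\<^sub>R g' (x i) \<theta>)"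

definition q_hat :: "('x \<Rightarrow> 'q \<Rightarrow> real) \<Rightarrow> nat \<Rightarrow> (nat \<Rightarrow> 'x) \<Rightarrow> 'q \<Rightarrow> real" where
  "q_hat g n x \<theta> = (\<Sum>i<n. g (x i) \<theta>) / real n"

definition label_mean :: "nat \<Rightarrow> (nat \<Rightarrow> real) \<Rightarrow> real" where
  "label_mean m y = (\<Sum>i<m. y i) / real m"

text \<open>\<open>has_asymptotic_variance M a T \<mu> v\<close>: for large \<open>n\<close>, \<open>T n\<close> is approximately normal
  with mean \<open>\<mu>\<close> and variance \<open>v n\<close>, the deviations \<open>T n - \<mu>\<close> being of order
  \<open>1 / sqrt (a n)\<close>. Rescaling by \<open>a n\<close>, instead of dividing by \<open>sqrt (v n)\<close>, also covers the
  degenerate limit (\<open>\<sigma> = 0\<close>, a point mass at 0).\<close>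

definition has_asymptotic_variance ::
  "'a measure \<Rightarrow> (nat \<Rightarrow> real) \<Rightarrow> (nat \<Rightarrow> 'a \<Rightarrow> real) \<Rightarrow> real \<Rightarrow> (nat \<Rightarrow> real) \<Rightarrow> bool" where
  "has_asymptotic_variance M a T \<mu> v \<longleftrightarrow>
     (\<forall>n. T n \<in> borel_measurable M) \<and>
     (\<exists>\<sigma>. (\<lambda>n. a n * v n) \<longlonglongrightarrow> \<sigma>\<^sup>2 \<and>
          weak_conv_m (\<lambda>n. distr M borel (\<lambda>\<omega>. sqrt (a n) * (T n \<omega> - \<mu>)))
                      (distr std_normal_distribution borel (\<lambda>z. \<sigma> * z)))"

definition avar_q_hat ::
  "'a measure \<Rightarrow> ('x \<Rightarrow> real ^ 'p \<Rightarrow> real) \<Rightarrow> ('x \<Rightarrow> real ^ 'p \<Rightarrow> real ^ 'p) \<Rightarrow>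
    ('a \<Rightarrow> 'x) \<Rightarrow> real ^ 'p \<Rightarrow> nat \<Rightarrow> nat \<Rightarrow> real" where
  "avar_q_hat M g g' X \<theta> n m =
     prob_space.variance M (\<lambda>\<omega>. g (X \<omega>) \<theta>) / real n +
     (mean_grad M g' X \<theta> \<bullet> (matrix_inv (info_matrix M g g' X \<theta>) *v mean_grad M g' X \<theta>)) / real m"

definition avar_label_mean :: "'a measure \<Rightarrow> ('a \<Rightarrow> real) \<Rightarrow> nat \<Rightarrow> real" where
  "avar_label_mean M y m = prob_space.variance M y / real m"

end

theory Submission
  imports Defs
begin

text \<open>Write \<open>G = g X \<theta>\<^sub>j\<close> and \<open>V = G (1 - G) = 1 / w\<close>. Since \<open>Y\<^sub>j\<close> is an indicator with conditional
  mean \<open>G\<close>, its variance splits as \<open>Var G + E V\<close>. With \<open>a = A\<^sup>-\<^sup>1 B\<close>, the expectation of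
  \<open>V - 2 a \<bullet> g' + w (a \<bullet> g')\<^sup>2 = (V - a \<bullet> g')\<^sup>2 / V \<ge> 0\<close> equals \<open>E V - B \<bullet> A\<^sup>-\<^sup>1 B\<close>, so
  \<open>B \<bullet> A\<^sup>-\<^sup>1 B \<le> E V\<close>. As \<open>r < n\<close>, also \<open>Var G / n \<le> Var G / r\<close>, strictly if \<open>Var G > 0\<close>. Asymptotic
  normality of the labeled mean is the central limit theorem along the sequence \<open>r\<close>.\<close>

text \<open>For \<open>c > 0\<close> scaling turns the cdf \<open>F\<close> into
  \<open>F (x / c)\<close>, so continuity points \<open>x\<close> of the scaled limit correspond to
  continuity points \<open>x / c\<close> of \<open>N\<close>.\<close>

lemma weak_conv_m_distr_mult:
  fixes N :: "real measure" and c :: real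
  assumes conv: "weak_conv_m M N" and c: "0 < c"
    and M: "\<And>n. sets (M n) = sets borel" and N: "sets N = sets borel"
  shows "weak_conv_m (\<lambda>n. distr (M n) borel (\<lambda>x. c * x)) (distr N borel (\<lambda>x. c * x))"
proof -
  have cdf: "cdf (distr L borel (\<lambda>x. c * x)) = (\<lambda>x. cdf L (x / c))" if L: "sets L = sets borel" for L
  proof
    fix x
    have "(\<lambda>x. c * x) -` {..x} \<inter> space L = {..x / c}"
      using c sets_eq_imp_space_eq[OF L] by (auto simp: field_simps)
    moreover have "(\<lambda>x. c * x) \<in> measurable L borel"
      unfolding measurable_cong_sets[OF L refl] by simp
    ultimately show "cdf (distr L borel (\<lambda>x. c * x)) x = cdf L (x / c)"
      by (simp add: cdf_def measure_distr)
  qed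
  show ?thesis
    unfolding weak_conv_m_def weak_conv_def cdf[OF M] cdf[OF N]
  proof (intro allI impI)
    fix x assume cont: "isCont (\<lambda>x. cdf N (x / c)) x"
    have "isCont (\<lambda>y. cdf N (c * y / c)) (x / c)"
      by (rule isCont_o2[of _ "\<lambda>y. c * y" "\<lambda>x. cdf N (x / c)"]) (use c cont in auto)
    then have "isCont (cdf N) (x / c)"
      using c by simp
    then show "(\<lambda>n. cdf (M n) (x / c)) \<longlonglongrightarrow> cdf N (x / c)"
      using conv by (simp add: weak_conv_m_def weak_conv_def)
  qed
qed

text \<open>Weak convergence is pointwise convergence of cdfs, so it survives passing to sample
  sizes \<open>r n\<close> that tend to infinity, monotonically or not.\<close>

lemma weak_conv_m_filterlim:
  assumes "weak_conv_m M N" and "filterlim r at_top sequentially"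
  shows "weak_conv_m (\<lambda>n. M (r n)) N"
  using assms unfolding weak_conv_m_def weak_conv_def
  by (auto intro: filterlim_compose[of "\<lambda>n. cdf (M n) x" for x])

text \<open>The central limit theorem for standardized sums, multiplied by \<open>s\<close>, takes
  the scaled form that \<open>has_asymptotic_variance\<close> asks for.\<close>

lemma (in prob_space) central_limit_theorem_mean:
  fixes Z :: "nat \<Rightarrow> 'a \<Rightarrow> real"
  assumes indep: "indep_vars (\<lambda>_. borel) Z UNIV"
    and mean: "\<And>n. expectation (Z n) = m" and s: "0 < s"
    and sq: "\<And>n. integrable M (\<lambda>\<omega>. (Z n \<omega>)\<^sup>2)"
    and var: "\<And>n. variance (Z n) = s\<^sup>2" and distr: "\<And>n. distr M borel (Z n) = D"
  shows "weak_conv_m (\<lambda>n. distr M borel (\<lambda>\<omega>. sqrt (real n) * ((\<Sum>i<n. Z i \<omega>) / real n - m)))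
           (distr std_normal_distribution borel (\<lambda>z. s * z))"
proof -
  have [measurable]: "Z n \<in> borel_measurable M" for n
    using indep by (simp add: indep_vars_def2)
  have std: "weak_conv_m
      (\<lambda>n. distr M borel (\<lambda>\<omega>. (\<Sum>i<n. Z i \<omega> - m) / sqrt (real n * s\<^sup>2))) std_normal_distribution"
    by (rule central_limit_theorem[OF indep mean s sq var distr])
  have scale: "s * ((\<Sum>i<n. Z i \<omega> - m) / sqrt (real n * s\<^sup>2))
      = sqrt (real n) * ((\<Sum>i<n. Z i \<omega>) / real n - m)" for n \<omega>
  \<comment> \<open>For \<open>n = 0\<close> both sides are 0, since the sum is empty and
    \<open>sqrt 0 = 0\<close>.\<close>
  proof (cases "n = 0")
    case False
    then have "sqrt (real n) * sqrt (real n) = real n" "sqrt (real n) \<noteq> 0"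
      by auto
    then show ?thesis
      using s False by (simp add: real_sqrt_mult sum_subtractf field_simps)
  qed simp
  show ?thesis
    using weak_conv_m_distr_mult[OF std s] 
    by (simp add: distr_distr comp_def scale del: times_divide_eq_right)
qed

lemma inner_outer_vector_mult: "a \<bullet> (outer v *v a) = (a \<bullet> v)\<^sup>2"
  by (simp add: outer_def matrix_vector_mult_def inner_vec_def power2_eq_square
      sum_product sum_distrib_left mult_ac)

lemma inner_scaleR_outer_vector_mult: "a \<bullet> ((c *\<^sub>R outer v) *v a) = c * (a \<bullet> v)\<^sup>2"
  by (simp add: scaleR_matrix_vector_assoc[symmetric] inner_outer_vector_mult)

text \<open>The form is linear in the matrix \<open>W\<close>, hence bounded in finite dimension;
  this lets it be exchanged with a matrix-valued integral.\<close>

lemma bounded_linear_quadratic_form: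
  fixes a :: "real ^ 'p"
  shows "bounded_linear (\<lambda>W :: real ^ 'p ^ 'p. a \<bullet> (W *v a))"
  by (rule linear_conv_bounded_linear[THEN iffD1], rule linearI)
    (simp_all add: matrix_vector_mult_add_rdistrib inner_add_right scaleR_matrix_vector_assoc[symmetric])

lemma mult_matrix_inv:
  assumes "invertible A"
  shows "A ** matrix_inv A = mat 1"
  using assms someI_ex[of "\<lambda>B. A ** B = mat 1 \<and> B ** A = mat 1"]
  by (simp add: invertible_def matrix_inv_def)

text \<open>This is a Cauchy-Schwarz inequality for the weight \<open>1 / v\<close>: the left side
  is the squared weighted norm of the projection of \<open>v\<close> onto the span of the components
  of \<open>h\<close>, the right side that of \<open>v\<close> itself.\<close>

lemma inner_matrix_inv_le_integral:
  fixes M :: "'a measure" and h :: "'a \<Rightarrow> real ^ 'p" and v :: "'a \<Rightarrow> real"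
  defines "A \<equiv> \<integral>\<omega>. (1 / v \<omega>) *\<^sub>R outer (h \<omega>) \<partial>M" and "B \<equiv> \<integral>\<omega>. h \<omega> \<partial>M"
  assumes pos: "AE \<omega> in M. 0 < v \<omega>" and v: "integrable M v" and h: "integrable M h"
    and W: "integrable M (\<lambda>\<omega>. (1 / v \<omega>) *\<^sub>R outer (h \<omega>))" and inv: "invertible A"
  shows "B \<bullet> (matrix_inv A *v B) \<le> (\<integral>\<omega>. v \<omega> \<partial>M)"
proof -
  \<comment> \<open>The normal equations \<open>A a = B\<close> single out the coefficients
    minimizing the integral of \<open>(v - a \<bullet> h)^2 / v\<close>.\<close>
  define a where "a = matrix_inv A *v B"
  have Aa: "A *v a = B"
    using inv by (simp add: a_def matrix_vector_mul_assoc mult_matrix_inv)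
  \<comment> \<open>The integral is \<open>a \<bullet> (A *v a)\<close>, which the normal equations
    turn into \<open>a \<bullet> B\<close>.\<close>
  have quad: "integrable M (\<lambda>\<omega>. (1 / v \<omega>) * (a \<bullet> h \<omega>)\<^sup>2)"
    "(\<integral>\<omega>. (1 / v \<omega>) * (a \<bullet> h \<omega>)\<^sup>2 \<partial>M) = a \<bullet> B"
    using integrable_bounded_linear[OF bounded_linear_quadratic_form W, of a]
      integral_bounded_linear[OF bounded_linear_quadratic_form W, of a] Aa
    by (simp_all only: inner_scaleR_outer_vector_mult A_def)
  have lin: "integrable M (\<lambda>\<omega>. a \<bullet> h \<omega>)" "(\<integral>\<omega>. a \<bullet> h \<omega> \<partial>M) = a \<bullet> B"
    using h by (simp_all add: B_def)
  have "0 \<le> (\<integral>\<omega>. v \<omega> - 2 * (a \<bullet> h \<omega>) + (1 / v \<omega>) * (a \<bullet> h \<omega>)\<^sup>2 \<partial>M)"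
  proof (rule integral_nonneg_AE, use pos in eventually_elim)
    fix \<omega> assume "0 < v \<omega>"
    then have "v \<omega> - 2 * (a \<bullet> h \<omega>) + (1 / v \<omega>) * (a \<bullet> h \<omega>)\<^sup>2 = (v \<omega> - a \<bullet> h \<omega>)\<^sup>2 / v \<omega>"
      by (simp add: field_simps power2_eq_square)
    with \<open>0 < v \<omega>\<close> show "0 \<le> v \<omega> - 2 * (a \<bullet> h \<omega>) + (1 / v \<omega>) * (a \<bullet> h \<omega>)\<^sup>2"
      by simp
  qed
  also have "\<dots> = (\<integral>\<omega>. v \<omega> \<partial>M) - a \<bullet> B"
    using v lin quad by simp
  finally show ?thesis
    by (simp add: a_def inner_commute)
qed

text \<open>Zero variance would force \<open>Z\<close> to equal its mean almost everywhere.\<close>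

lemma (in prob_space) variance_pos:
  fixes Z :: "'a \<Rightarrow> real"
  assumes "integrable M Z" "integrable M (\<lambda>\<omega>. (Z \<omega>)\<^sup>2)" "\<nexists>c. AE \<omega> in M. Z \<omega> = c"
  shows "0 < variance Z"
proof -
  have "integrable M (\<lambda>\<omega>. (Z \<omega> - expectation Z)\<^sup>2)"
    using assms by (simp add: power2_diff)
  then have "variance Z = 0 \<longleftrightarrow> (AE \<omega> in M. (Z \<omega> - expectation Z)\<^sup>2 = 0)"
    by (intro integral_nonneg_eq_0_iff_AE) auto
  then have "variance Z \<noteq> 0"
    using assms(3) by auto
  then show ?thesis
    using variance_positive[of Z] by linarith
qed

text \<open>Both estimators are rescaled by the same \<open>r n\<close>, so their variances are
  comparable. The guard \<open>0 < r n\<close> matters: at \<open>r n = 0\<close> division by zero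
  would make the variance of the labeled mean 0.\<close>

theorem corollary1:
  fixes M :: "'a measure"
    and X :: "'a \<Rightarrow> real ^ 'd" and Y :: "'a \<Rightarrow> real ^ 'c"
    and Xs :: "nat \<Rightarrow> 'a \<Rightarrow> real ^ 'd" and Ys :: "nat \<Rightarrow> 'a \<Rightarrow> real ^ 'c"
    and r :: "nat \<Rightarrow> nat" and \<gamma> :: real
    and \<Theta> :: "(real ^ 'p) set" and \<theta> :: "'c \<Rightarrow> real ^ 'p"
    and g :: "real ^ 'd \<Rightarrow> real ^ 'p \<Rightarrow> real"
    and g' :: "real ^ 'd \<Rightarrow> real ^ 'p \<Rightarrow> real ^ 'p"
    and \<theta>hat :: "nat \<Rightarrow> 'a \<Rightarrow> real ^ 'p"
    and j :: 'c
  assumes "prob_space M"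
    and "X \<in> borel_measurable M" and "Y \<in> borel_measurable M"
    and label: "\<And>\<omega> k. \<omega> \<in> space M \<Longrightarrow> Y \<omega> $ k \<in> {0, 1}"
    \<comment> \<open>random sample from the distribution of (X, Y)\<close>
    and sample_indep: "prob_space.indep_vars M (\<lambda>_. borel) (\<lambda>i \<omega>. (Xs i \<omega>, Ys i \<omega>)) UNIV"
    and sample_distr: "\<And>i. distr M borel (\<lambda>\<omega>. (Xs i \<omega>, Ys i \<omega>)) = distr M borel (\<lambda>\<omega>. (X \<omega>, Y \<omega>))"
    \<comment> \<open>numbers of labeled observations\<close>
    and unlabeled: "\<And>n. n > 0 \<Longrightarrow> r n < n"
    and labeled: "filterlim r at_top sequentially"
    and label_rate: "(\<lambda>n. real (r n) / real n) \<longlonglongrightarrow> \<gamma>"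
    \<comment> \<open>semiparametric model\<close>
    and param_space: "open \<Theta>" "\<And>k. \<theta> k \<in> \<Theta>"
    and g_meas: "(\<lambda>(t, \<eta>). g t \<eta>) \<in> borel_measurable borel"
    and g_deriv: "\<And>t \<eta>. \<eta> \<in> \<Theta> \<Longrightarrow> GDERIV (g t) \<eta> :> g' t \<eta>"
    and model: "\<And>k. AE \<omega> in M. real_cond_exp M (vimage_algebra (space M) X borel)
                        (indicator {\<omega> \<in> space M. Y \<omega> $ k = 1}) \<omega> = g (X \<omega>) (\<theta> k)"
    and nondegenerate: "AE \<omega> in M. 0 < g (X \<omega>) (\<theta> j) \<and> g (X \<omega>) (\<theta> j) < 1"
    \<comment> \<open>the required means exist\<close>
    and "integrable M (\<lambda>\<omega>. weight g (X \<omega>) (\<theta> j) *\<^sub>R outer (g' (X \<omega>) (\<theta> j)))"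
    and "integrable M (\<lambda>\<omega>. g' (X \<omega>) (\<theta> j))"
    and "invertible (info_matrix M g g' X (\<theta> j))"
    \<comment> \<open>the estimator of the parameter, computed from the labeled data\<close>
    and \<theta>hat_rv: "\<And>n. \<theta>hat n \<in> borel_measurable M"
    and \<theta>hat_labeled: "\<And>n. \<exists>T. \<forall>\<omega>\<in>space M. \<theta>hat n \<omega> = T (\<lambda>i\<in>{..<r n}. (Xs i \<omega>, Ys i \<omega> $ j))"
    and \<theta>hat_root: "(\<lambda>n. measure M {\<omega> \<in> space M. \<theta>hat n \<omega> \<in> \<Theta> \<and>
                        irls_score g g' (r n) (\<lambda>i. Xs i \<omega>) (\<lambda>i. Ys i \<omega> $ j) (\<theta>hat n \<omega>) = 0})
                      \<longlonglongrightarrow> 1"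
    \<comment> \<open>the standard asymptotic theory applies to the weighted least squares estimator\<close>
    and asymptotics: "has_asymptotic_variance M (\<lambda>n. real (r n))
                        (\<lambda>n \<omega>. q_hat g n (\<lambda>i. Xs i \<omega>) (\<theta>hat n \<omega>)) (\<integral>\<omega>. Y \<omega> $ j \<partial>M)
                        (\<lambda>n. avar_q_hat M g g' X (\<theta> j) n (r n))"
  shows "has_asymptotic_variance M (\<lambda>n. real (r n))
           (\<lambda>n \<omega>. label_mean (r n) (\<lambda>i. Ys i \<omega> $ j)) (\<integral>\<omega>. Y \<omega> $ j \<partial>M)
           (\<lambda>n. avar_label_mean M (\<lambda>\<omega>. Y \<omega> $ j) (r n))
         \<and> (\<forall>n. 0 < n \<longrightarrow> 0 < r n \<longrightarrow>
              avar_q_hat M g g' X (\<theta> j) n (r n) \<le> avar_label_mean M (\<lambda>\<omega>. Y \<omega> $ j) (r n))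
         \<and> ((\<nexists>c. AE \<omega> in M. g (X \<omega>) (\<theta> j) = c) \<longrightarrow>
              (\<forall>n. 0 < n \<longrightarrow> 0 < r n \<longrightarrow>
                avar_q_hat M g g' X (\<theta> j) n (r n) < avar_label_mean M (\<lambda>\<omega>. Y \<omega> $ j) (r n)))"
proof -
  interpret prob_space M by fact
  note [measurable] = assms(2,3)
  define G where "G \<omega> = g (X \<omega>) (\<theta> j)" for \<omega>
  define V where "V \<omega> = G \<omega> * (1 - G \<omega>)" for \<omega>
  define y where "y \<omega> = Y \<omega> $ j" for \<omega>
  define q where "q = expectation y"
  have nth_meas: "(\<lambda>p. snd p $ j) \<in> borel_measurable (borel :: ((real ^ 'd) \<times> (real ^ 'c)) measure)"
    by (intro borel_measurable_continuous_onI continuous_intros)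
  have y_meas [measurable]: "y \<in> borel_measurable M"
    using measurable_compose[OF assms(3) borel_measurable_continuous_onI, of "\<lambda>v. v $ j"]
    by (simp add: y_def[abs_def] continuous_intros)
  have y01: "y \<omega> \<in> {0, 1}" if "\<omega> \<in> space M" for \<omega>
    using label[OF that] by (simp add: y_def)
  have y_int: "integrable M y"
    by (rule integrable_const_bound[of _ 1]) (use y01 in \<open>fastforce intro!: AE_I2\<close>)+
  have y_sq: "(y \<omega>)\<^sup>2 = y \<omega>" if "\<omega> \<in> space M" for \<omega>
    using y01[OF that] by auto
  have y_sq_int: "integrable M (\<lambda>\<omega>. (y \<omega>)\<^sup>2)"
    using y_int y_sq by (simp cong: Bochner_Integration.integrable_cong)
  have var_y: "variance y = q - q\<^sup>2"
    using variance_eq[OF y_int y_sq_int] y_sq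
    by (simp add: q_def cong: Bochner_Integration.integral_cong)

  have "(\<lambda>t. (t, \<theta> j)) \<in> borel_measurable (borel :: (real ^ 'd) measure)"
    by (intro borel_measurable_continuous_onI continuous_intros)
  from measurable_compose[OF this g_meas] have "(\<lambda>t. g t (\<theta> j)) \<in> borel_measurable borel"
    by simp
  then have G_meas [measurable]: "G \<in> borel_measurable M"
    unfolding G_def by measurable
  have G01: "AE \<omega> in M. 0 < G \<omega> \<and> G \<omega> < 1"
    using nondegenerate by (simp add: G_def)
  have G_int: "integrable M G"
    by (rule integrable_const_bound[of _ 1]) (use G01 in auto)
  have "AE \<omega> in M. norm ((G \<omega>)\<^sup>2) \<le> 1"
    using G01 by eventually_elim (simp add: power_le_one)
  then have G_sq_int: "integrable M (\<lambda>\<omega>. (G \<omega>)\<^sup>2)"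
    by (rule integrable_const_bound) simp
  have V_alt: "V = (\<lambda>\<omega>. G \<omega> - (G \<omega>)\<^sup>2)"
    by (auto simp: V_def power2_eq_square algebra_simps)
  have V_int: "integrable M V"
    unfolding V_alt using G_int G_sq_int by simp
  have V_pos: "AE \<omega> in M. 0 < V \<omega>"
    using G01 by eventually_elim (simp add: V_def)

  \<comment> \<open>Tower property: the conditional probability of label \<open>j\<close> given
    \<open>X\<close> integrates to the probability of that label, which is \<open>q\<close>.\<close>
  have EG: "expectation G = q"
  proof -
    let ?F = "vimage_algebra (space M) X borel"
    let ?I = "indicator {\<omega> \<in> space M. Y \<omega> $ j = 1} :: 'a \<Rightarrow> real"
    have "subalgebra M ?F"
      unfolding subalgebra_def
      using measurable_iff_sets[of X M borel] assms(2) by simp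
    then interpret F: finite_measure_subalgebra M ?F
      by unfold_locales
    have I: "?I \<omega> = y \<omega>" if "\<omega> \<in> space M" for \<omega>
      using y01[OF that] that by (auto simp: y_def indicator_def)
    have "integrable M ?I"
      using y_int I by (simp cong: Bochner_Integration.integrable_cong)
    then have "expectation (real_cond_exp M ?F ?I) = expectation ?I"
      by (rule F.real_cond_exp_int)
    also have "\<dots> = q"
      unfolding q_def using I by (rule Bochner_Integration.integral_cong[OF refl])
    finally show ?thesis
      using integral_cong_AE[OF _ _ model[of j]] by (simp add: G_def[symmetric])
  qed
  have EV: "expectation V = q - expectation (\<lambda>\<omega>. (G \<omega>)\<^sup>2)"
    unfolding V_alt using G_int G_sq_int EG by simp
  have var_G: "variance G = expectation (\<lambda>\<omega>. (G \<omega>)\<^sup>2) - q\<^sup>2"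
    using variance_eq[OF G_int G_sq_int] EG by simp
  \<comment> \<open>Law of total variance; the second moment of \<open>G\<close> cancels.\<close>
  have var_split: "variance y = variance G + expectation V"
    using var_y var_G EV by simp
  have EV_pos: "0 < expectation V"
    using integral_less_AE_space[of "\<lambda>_. 0" V] V_int V_pos by (simp add: emeasure_space_1)
  \<comment> \<open>The central limit theorem needs a positive standard deviation;
    \<open>nondegenerate\<close> supplies it through \<open>V\<close>.\<close>
  have var_y_pos: "0 < variance y"
    using var_split EV_pos variance_positive[of G] by linarith

  \<comment> \<open>The joint law of a sample pair is pushed forward to the single coordinate
    \<open>j\<close> of the label.\<close>
  have y_distr: "distr M borel (\<lambda>\<omega>. Ys i \<omega> $ j) = distr M borel y" for i
  proof -
    have [measurable]: "(\<lambda>\<omega>. (Xs i \<omega>, Ys i \<omega>)) \<in> borel_measurable M"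
      using sample_indep by (simp add: indep_vars_def2)
    have [measurable]: "(\<lambda>\<omega>. (X \<omega>, Y \<omega>)) \<in> borel_measurable M"
      by (rule borel_measurable_Pair) fact+
    show ?thesis
      using arg_cong[OF sample_distr[of i], of "\<lambda>D. distr D borel (\<lambda>p. snd p $ j)"]
      by (simp add: distr_distr nth_meas comp_def y_def[abs_def])
  qed
  have indep: "indep_vars (\<lambda>_. borel) (\<lambda>i \<omega>. Ys i \<omega> $ j) UNIV"
    using indep_vars_compose2[OF sample_indep, of "\<lambda>_ p. snd p $ j"] nth_meas by simp
  then have Ys_meas [measurable]: "(\<lambda>\<omega>. Ys i \<omega> $ j) \<in> borel_measurable M" for i
    by (simp add: indep_vars_def2)
  have transfer: "expectation (\<lambda>\<omega>. f (Ys i \<omega> $ j)) = expectation (\<lambda>\<omega>. f (y \<omega>))"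
    if "f \<in> borel_measurable borel" for f :: "real \<Rightarrow> real" and i
    using arg_cong[OF y_distr[of i], of "\<lambda>D. integral\<^sup>L D f"] that by (simp add: integral_distr)
  have clt: "weak_conv_m (\<lambda>n. distr M borel
        (\<lambda>\<omega>. sqrt (real n) * ((\<Sum>i<n. Ys i \<omega> $ j) / real n - q)))
      (distr std_normal_distribution borel (\<lambda>z. sqrt (variance y) * z))"
  proof (rule central_limit_theorem_mean[OF indep _ _ _ _ y_distr])
    show mean: "expectation (\<lambda>\<omega>. Ys n \<omega> $ j) = q" for n
      using transfer[of "\<lambda>x. x"] by (simp add: q_def)
    show "variance (\<lambda>\<omega>. Ys n \<omega> $ j) = (sqrt (variance y))\<^sup>2" for n
      unfolding mean using transfer[of "\<lambda>x. (x - q)\<^sup>2"] var_y_pos by (simp add: q_def)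
    have "integrable (distr M borel (\<lambda>\<omega>. Ys n \<omega> $ j)) (\<lambda>x. x\<^sup>2)" for n
      unfolding y_distr using y_sq_int by (simp add: integrable_distr_eq)
    then show "integrable M (\<lambda>\<omega>. (Ys n \<omega> $ j)\<^sup>2)" for n
      by (simp add: integrable_distr_eq)
    show "0 < sqrt (variance y)"
      using var_y_pos by simp
  qed
  \<comment> \<open>The rescaled variance is constant only once \<open>r n > 0\<close>; for instance
    \<open>r 1 = 0\<close> always.\<close>
  have "\<forall>\<^sub>F n in sequentially. 0 < r n"
    by (rule eventually_compose_filterlim[OF eventually_gt_at_top labeled])
  then have "\<forall>\<^sub>F n in sequentially. real (r n) * avar_label_mean M y (r n) = (sqrt (variance y))\<^sup>2"
    by eventually_elim (use var_y_pos in \<open>simp add: avar_label_mean_def\<close>)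
  then have asym: "has_asymptotic_variance M (\<lambda>n. real (r n))
      (\<lambda>n \<omega>. label_mean (r n) (\<lambda>i. Ys i \<omega> $ j)) q (\<lambda>n. avar_label_mean M y (r n))"
    unfolding has_asymptotic_variance_def label_mean_def
    using weak_conv_m_filterlim[OF clt labeled]
    by (intro conjI allI exI[of _ "sqrt (variance y)"] tendsto_eventually) measurable

  define C where "C = mean_grad M g' X (\<theta> j) \<bullet>
    (matrix_inv (info_matrix M g g' X (\<theta> j)) *v mean_grad M g' X (\<theta> j))"
  \<comment> \<open>With \<open>v = V\<close> the factor \<open>1 / v\<close> is exactly
    \<open>weight\<close>, so the matrix \<open>A\<close> of the inequality is
    \<open>info_matrix\<close>.\<close>
  have C_le: "C \<le> expectation V"
    unfolding C_def mean_grad_def info_matrix_def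
    using inner_matrix_inv_le_integral[where M = M and v = V and h = "\<lambda>\<omega>. g' (X \<omega>) (\<theta> j)"]
      assms(16-18) V_pos V_int
    by (simp add: weight_def V_def[abs_def] G_def info_matrix_def)
  have avar: "avar_q_hat M g g' X (\<theta> j) n m = variance G / real n + C / real m" for n m
    by (simp add: avar_q_hat_def C_def G_def[abs_def])
  have avar_y: "avar_label_mean M y m = variance G / real m + expectation V / real m" for m
    by (simp add: avar_label_mean_def var_split add_divide_distrib)
  have C_part: "C / real m \<le> expectation V / real m" for m
    using C_le by (simp add: divide_right_mono)
  have le: "avar_q_hat M g g' X (\<theta> j) n (r n) \<le> avar_label_mean M y (r n)"
    if "0 < n" "0 < r n" for n
    using C_part[of "r n"] unlabeled[of n] that variance_positive[of G]
    by (auto simp: avar avar_y intro!: add_mono divide_left_mono)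
  \<comment> \<open>Strictness comes from the \<open>variance G\<close> term alone; the comparison
    of \<open>C\<close> with the mean of \<open>V\<close> may be an equality.\<close>
  have less: "avar_q_hat M g g' X (\<theta> j) n (r n) < avar_label_mean M y (r n)"
    if "\<nexists>c. AE \<omega> in M. G \<omega> = c" "0 < n" "0 < r n" for n
    using C_part[of "r n"] unlabeled[of n] that variance_pos[OF G_int G_sq_int]
    by (auto simp: avar avar_y intro!: add_less_le_mono divide_strict_left_mono)
  show ?thesis
    using asym le less by (simp add: q_def y_def[abs_def] G_def)
qed

end
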